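(* Let $\mathcal{A},\mathcal{B}\in\mathbb{C}^{\mathbf{N}(n)\times\mathbf{N}(n)}$ with $\mathrm{ind}(\mathcal{A})=\mathrm{ind}(\mathcal{B})=1$. Then the following statements are equivalent: (a) $\mathcal{A}^{\mathrm{core}}=\mathcal{B}*_n(\mathcal{A}*_n\mathcal{B})^{\#}$; (b) $\mathcal{A}^{\mathrm{core}}*_n\mathcal{A}*_n\mathcal{B}=\mathcal{B}*_n\mathcal{A}*_n\mathcal{A}^{\mathrm{core}}$ and $\mathscr{R}(\mathcal{A})\subseteq\mathscr{R}(\mathcal{A}*_n\mathcal{B})$; (c) $(\mathcal{A}*_n\mathcal{B})^{\#}=(\mathcal{A}*_n\mathcal{B})^{\mathrm{core}}=\mathcal{B}^{\mathrm{core}}*_n\mathcal{A}^{\mathrm{core}}$ and $\mathscr{R}(\mathcal{A})\subseteq\mathscr{R}(\mathcal{B})$.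
   Context: Here $\mathbf{N}(n)=N_1\times\cdots\times N_n$ and $\mathbb{C}^{\mathbf{N}(n)\times\mathbf{N}(n)}$ is the set of complex tensors $\mathcal{A}=(a_{i_1\ldots i_n j_1\ldots j_n})$ with $1\le i_k,j_k\le N_k$. The Einstein product is $(\mathcal{A}*_n\mathcal{B})_{i_1\ldots i_n j_1\ldots j_n}=\sum_{k_1,\ldots,k_n}a_{i_1\ldots i_n k_1\ldots k_n}b_{k_1\ldots k_n j_1\ldots j_n}$ (and similarly $\mathcal{A}*_n\mathcal{X}\in\mathbb{C}^{\mathbf{N}(n)}$ for $\mathcal{X}\in\mathbb{C}^{\mathbf{N}(n)}$), powers are taken with respect to $*_n$, and $\mathcal{A}^*$ is the conjugate transpose (swap the first $n$ and last $n$ indices and conjugate). The range is $\mathscr{R}(\mathcal{A})=\{\mathcal{A}*_n\mathcal{X}:\mathcal{X}\in\mathbb{C}^{\mathbf{N}(n)}\}$. The index $\mathrm{ind}(\mathcal{A})$ is the smallest positive integer $k$ with $\mathscr{R}(\mathcal{A}^k)=\mathscr{R}(\mathcal{A}^{k+1})$. The core inverse $\mathcal{A}^{\mathrm{core}}$ is the tensor $\mathcal{X}$ (unique when it exists; it exists when $\mathrm{ind}(\mathcal{A})=1$) with $(\mathcal{A}*_n\mathcal{X})^*=\mathcal{A}*_n\mathcal{X}$, $\mathcal{X}*_n\mathcal{A}^2=\mathcal{A}$, $\mathcal{A}*_n\mathcal{X}^2=\mathcal{X}$. The group inverse $\mathcal{A}^{\#}$ is the tensor $\mathcal{X}$ (unique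 when it exists; it exists when $\mathrm{ind}(\mathcal{A})=1$) with $\mathcal{A}^2*_n\mathcal{X}=\mathcal{A}$, $\mathcal{X}*_n\mathcal{A}*_n\mathcal{X}=\mathcal{X}$, $\mathcal{X}*_n\mathcal{A}=\mathcal{A}*_n\mathcal{X}$. An equality involving a core or group inverse is understood to include its existence. *)

theory Defs
  imports Complex_Main "HOL-Library.FuncSet"
begin

text \<open>
  Multi-indices \<open>(i\<^sub>1, \<dots>, i\<^sub>n)\<close> with \<open>1 \<le> i\<^sub>k \<le> N\<^sub>k\<close> are extensional functions on \<open>{1..n}\<close>, and
  tensors are extensional functions on (pairs of) multi-indices, so that equality of
  tensors is HOL equality.
\<close>

type_synonym mindex = "nat \<Rightarrow> nat"
type_synonym tensor = "mindex \<times> mindex \<Rightarrow> complex"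
type_synonym tvector = "mindex \<Rightarrow> complex"

definition mindices :: "nat \<Rightarrow> (nat \<Rightarrow> nat) \<Rightarrow> mindex set" where
  "mindices n N = (\<Pi>\<^sub>E k\<in>{1..n}. {1..N k})"

definition tensors :: "nat \<Rightarrow> (nat \<Rightarrow> nat) \<Rightarrow> tensor set" where
  "tensors n N = (mindices n N \<times> mindices n N \<rightarrow>\<^sub>E UNIV)"

definition tvectors :: "nat \<Rightarrow> (nat \<Rightarrow> nat) \<Rightarrow> tvector set" where
  "tvectors n N = (mindices n N \<rightarrow>\<^sub>E UNIV)"

definition einstein :: "nat \<Rightarrow> (nat \<Rightarrow> nat) \<Rightarrow> tensor \<Rightarrow> tensor \<Rightarrow> tensor" where
  "einstein n N A B =
     (\<lambda>(i, j) \<in> mindices n N \<times> mindices n N. \<Sum>k\<in>mindices n N. A (i, k) * B (k, j))"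

abbreviation einstein_syntax ("(_ \<star>\<^bsub>_,_\<^esub> _)" [70, 0, 0, 71] 70) where
  "A \<star>\<^bsub>n,N\<^esub> B \<equiv> einstein n N A B"

definition einstein_vec :: "nat \<Rightarrow> (nat \<Rightarrow> nat) \<Rightarrow> tensor \<Rightarrow> tvector \<Rightarrow> tvector" where
  "einstein_vec n N A X = (\<lambda>i \<in> mindices n N. \<Sum>k\<in>mindices n N. A (i, k) * X k)"

definition id_tensor :: "nat \<Rightarrow> (nat \<Rightarrow> nat) \<Rightarrow> tensor" where
  "id_tensor n N = (\<lambda>(i, j) \<in> mindices n N \<times> mindices n N. if i = j then 1 else 0)"

primrec tpower :: "nat \<Rightarrow> (nat \<Rightarrow> nat) \<Rightarrow> tensor \<Rightarrow> nat \<Rightarrow> tensor" where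
  "tpower n N A 0 = id_tensor n N"
| "tpower n N A (Suc k) = tpower n N A k \<star>\<^bsub>n,N\<^esub> A"

definition ctranspose :: "nat \<Rightarrow> (nat \<Rightarrow> nat) \<Rightarrow> tensor \<Rightarrow> tensor" where
  "ctranspose n N A = (\<lambda>(i, j) \<in> mindices n N \<times> mindices n N. cnj (A (j, i)))"

definition trange :: "nat \<Rightarrow> (nat \<Rightarrow> nat) \<Rightarrow> tensor \<Rightarrow> tvector set" where
  "trange n N A = einstein_vec n N A ` tvectors n N"

definition tindex :: "nat \<Rightarrow> (nat \<Rightarrow> nat) \<Rightarrow> tensor \<Rightarrow> nat" where
  "tindex n N A =
     (LEAST k. 1 \<le> k \<and> trange n N (tpower n N A k) = trange n N (tpower n N A (k + 1)))"

definition is_core_inverse :: "nat \<Rightarrow> (nat \<Rightarrow> nat) \<Rightarrow> tensor \<Rightarrow> tensor \<Rightarrow> bool" where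
  "is_core_inverse n N A X \<longleftrightarrow>
     X \<in> tensors n N \<and>
     ctranspose n N (A \<star>\<^bsub>n,N\<^esub> X) = A \<star>\<^bsub>n,N\<^esub> X \<and>
     X \<star>\<^bsub>n,N\<^esub> tpower n N A 2 = A \<and>
     A \<star>\<^bsub>n,N\<^esub> tpower n N X 2 = X"

definition is_group_inverse :: "nat \<Rightarrow> (nat \<Rightarrow> nat) \<Rightarrow> tensor \<Rightarrow> tensor \<Rightarrow> bool" where
  "is_group_inverse n N A X \<longleftrightarrow>
     X \<in> tensors n N \<and>
     tpower n N A 2 \<star>\<^bsub>n,N\<^esub> X = A \<and>
     X \<star>\<^bsub>n,N\<^esub> A \<star>\<^bsub>n,N\<^esub> X = X \<and>
     X \<star>\<^bsub>n,N\<^esub> A = A \<star>\<^bsub>n,N\<^esub> X"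

text \<open>
  The operators below denote the respective inverse only when it exists; existence has to be
  asserted separately by \<open>core_invertible\<close> and \<open>group_invertible\<close>.
\<close>

definition core_invertible :: "nat \<Rightarrow> (nat \<Rightarrow> nat) \<Rightarrow> tensor \<Rightarrow> bool" where
  "core_invertible n N A \<longleftrightarrow> (\<exists>X. is_core_inverse n N A X)"

definition group_invertible :: "nat \<Rightarrow> (nat \<Rightarrow> nat) \<Rightarrow> tensor \<Rightarrow> bool" where
  "group_invertible n N A \<longleftrightarrow> (\<exists>X. is_group_inverse n N A X)"

definition core_inv :: "nat \<Rightarrow> (nat \<Rightarrow> nat) \<Rightarrow> tensor \<Rightarrow> tensor" where
  "core_inv n N A = (THE X. is_core_inverse n N A X)"

definition group_inv :: "nat \<Rightarrow> (nat \<Rightarrow> nat) \<Rightarrow> tensor \<Rightarrow> tensor" where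
  "group_inv n N A = (THE X. is_group_inverse n N A X)"

end

theory Submission
  imports Defs
begin

text \<open>
  The Einstein product makes the square tensors of a fixed shape a finite-dimensional complex
  algebra with an involution, so everything can be done with identities in an associative algebra.
  Three facts link the algebra with the notions of the theorem.

  \<^item> A range inclusion \<open>R(A) \<subseteq> R(C)\<close> is a factorization \<open>A = C \<cdot> Y\<close> (\<open>range_subset_iff\<close>).
  \<^item> By finite dimension every tensor \<open>A\<close> satisfies a nontrivial polynomial equation. Dividing by its
    lowest nonzero coefficient gives \<open>A\<^sup>k = A\<^sup>k\<^sup>+\<^sup>1 \<cdot> S = S \<cdot> A\<^sup>k\<^sup>+\<^sup>1\<close> (\<open>pow_stabilizes\<close>). Hence the index is
    well defined, and a tensor \<open>C\<close> of the form \<open>C\<^sup>2 \<cdot> Z\<close> is also of the form \<open>S \<cdot> C\<^sup>2\<close>, which makes it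
    group invertible (\<open>group_inverse_exists\<close>).
  \<^item> \<open>B\<^sup>* \<cdot> B\<close> can be cancelled to \<open>B\<close> because the sum of \<open>|d\<^sub>k|\<^sup>2\<close> vanishes only for \<open>d = 0\<close>. Together
    with the previous point, applied to \<open>B\<^sup>* \<cdot> B\<close>, this yields a Hermitian projector \<open>B \<cdot> X\<close> that fixes
    \<open>B\<close>; multiplying the group inverse of \<open>B\<close> by it from the right gives the core inverse
    (\<open>core_inverse_exists\<close>).

  Now let \<open>a\<close> and \<open>b\<close> be the core inverses of \<open>A\<close> and \<open>B\<close>, \<open>C = A \<cdot> B\<close>, \<open>G\<close> the group inverse of \<open>C\<close>, and
  \<open>P = A \<cdot> a\<close> the orthogonal projector onto the range of \<open>A\<close>. If \<open>a = B \<cdot> G\<close>, then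
  \<open>a \<cdot> A \<cdot> B = B \<cdot> G \<cdot> C\<close> and \<open>B \<cdot> A \<cdot> a = B \<cdot> C \<cdot> G\<close> agree, and \<open>A = A \<cdot> a \<cdot> A = C \<cdot> G \<cdot> A\<close>; so (a) implies (b).
  If (b) holds, commutation gives \<open>C \<cdot> P = C\<close>, and writing \<open>A = C \<cdot> Y\<close> one gets \<open>P = C \<cdot> Y \<cdot> a\<close>, hence
  \<open>C = C\<^sup>2 \<cdot> (Y \<cdot> a)\<close>. Thus \<open>G\<close> exists, and \<open>C \<cdot> G = P\<close>. Since \<open>P\<close> is Hermitian, \<open>G\<close> is also the core inverse
  of \<open>C\<close>, and \<open>B \<cdot> G = B \<cdot> P \<cdot> G = a \<cdot> C \<cdot> G = a\<close>. From there \<open>b \<cdot> a = b \<cdot> B \<cdot> G = G\<close>, because \<open>b \<cdot> B\<close> acts as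
  the identity on the range of \<open>B\<close>, which contains that of \<open>A\<close> and so that of \<open>G\<close>; this is (c).
  Finally (c) implies (a), since \<open>B \<cdot> b\<close> fixes the range of \<open>B\<close> and hence \<open>a\<close>.
\<close>

section \<open>Linear dependence\<close>

text \<open>More vectors than coordinates are linearly dependent.\<close>

lemma exists_nontrivial_relation:
  fixes v :: "'m \<Rightarrow> 'e \<Rightarrow> 'a::field"
  assumes "finite E" and "finite M" and "card E < card M"
  shows "\<exists>c. (\<exists>m\<in>M. c m \<noteq> 0) \<and> (\<forall>e\<in>E. (\<Sum>m\<in>M. c m * v m e) = 0)"
  using assms
proof (induction E arbitrary: v M rule: finite_induct)
  case empty
  then have "M \<noteq> {}" by auto
  then show ?case by (intro exI[of _ "\<lambda>_. 1"]) auto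
next
  case (insert x E)
  show ?case
  proof (cases "\<forall>m\<in>M. v m x = 0")
    case True
    obtain c where "\<exists>m\<in>M. c m \<noteq> 0" "\<forall>e\<in>E. (\<Sum>m\<in>M. c m * v m e) = 0"
      using insert.IH[of M v] insert.prems insert.hyps by auto
    with True show ?thesis by (intro exI[of _ c]) auto
  next
    case False
    \<comment> \<open>Eliminate the coordinate \<open>x\<close> with the pivot vector \<open>v p\<close>.\<close>
    then obtain p where p: "p \<in> M" "v p x \<noteq> 0" by auto
    define M' where "M' = M - {p}"
    define v' where "v' m e = v m e - v m x / v p x * v p e" for m e
    have "finite M'" "card E < card M'"
      using insert.prems insert.hyps p by (auto simp: M'_def)
    then obtain c where c: "\<exists>m\<in>M'. c m \<noteq> 0" "\<forall>e\<in>E. (\<Sum>m\<in>M'. c m * v' m e) = 0"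
      using insert.IH[of M' v'] by auto
    define c' where "c' m = (if m = p then - (\<Sum>m\<in>M'. c m * v m x) / v p x else c m)" for m
    have split: "(\<Sum>m\<in>M. c' m * v m e) = c' p * v p e + (\<Sum>m\<in>M'. c m * v m e)" for e
    proof -
      have "(\<Sum>m\<in>M. c' m * v m e) = c' p * v p e + (\<Sum>m\<in>M'. c' m * v m e)"
        unfolding M'_def using p insert.prems by (simp add: sum.remove)
      moreover have "(\<Sum>m\<in>M'. c' m * v m e) = (\<Sum>m\<in>M'. c m * v m e)"
        by (rule sum.cong) (auto simp: c'_def M'_def)
      ultimately show ?thesis by simp
    qed
    have "(\<Sum>m\<in>M. c' m * v m x) = 0"
      unfolding split using p by (simp add: c'_def)
    moreover have "(\<Sum>m\<in>M. c' m * v m e) = 0" if "e \<in> E" for e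
    proof -
      have "(\<Sum>m\<in>M'. c m * v' m e)
          = (\<Sum>m\<in>M'. c m * v m e - c m * v m x * (v p e / v p x))"
        by (rule sum.cong) (auto simp: v'_def algebra_simps)
      also have "\<dots> = (\<Sum>m\<in>M'. c m * v m e) - (\<Sum>m\<in>M'. c m * v m x) * (v p e / v p x)"
        by (simp only: sum_subtractf sum_distrib_right)
      also have "\<dots> = (\<Sum>m\<in>M. c' m * v m e)"
        unfolding split by (simp add: c'_def)
      finally show ?thesis using c that by simp
    qed
    moreover have "\<exists>m\<in>M. c' m \<noteq> 0"
      using c(1) by (auto simp: c'_def M'_def)
    ultimately show ?thesis by (intro exI[of _ c']) auto
  qed
qed

section \<open>The algebra of tensors\<close>

text \<open>
  The locale only fixes the shape, to shorten the notation. The carrier \<open>T\<close> seldom matters: the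
  product and the conjugate transpose read only the entries at multi-indices and always return
  tensors, so that associativity and the rule for the conjugate transpose of a product hold for
  arbitrary functions. Membership in \<open>T\<close> is needed for the unit laws and for \<open>star (star A) = A\<close>.
\<close>

locale tensor_algebra =
  fixes n :: nat and N :: "nat \<Rightarrow> nat"
begin

abbreviation "I \<equiv> mindices n N"
abbreviation "T \<equiv> tensors n N"
abbreviation prod_tensor (infixl "\<cdot>" 70) where "A \<cdot> B \<equiv> einstein n N A B"
abbreviation "star \<equiv> ctranspose n N"
abbreviation "one \<equiv> id_tensor n N"
abbreviation "pow \<equiv> tpower n N"
abbreviation "range_of \<equiv> trange n N"

lemma finite_mindices [simp]: "finite I"
  by (auto simp: mindices_def intro!: finite_PiE)

lemma tensor_eqI:
  "A \<in> T \<Longrightarrow> B \<in> T \<Longrightarrow> (\<And>i j. i \<in> I \<Longrightarrow> j \<in> I \<Longrightarrow> A (i, j) = B (i, j)) \<Longrightarrow> A = B"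
  unfolding tensors_def by (rule PiE_ext) auto

lemma einstein_apply: "i \<in> I \<Longrightarrow> j \<in> I \<Longrightarrow> (A \<cdot> B) (i, j) = (\<Sum>k\<in>I. A (i, k) * B (k, j))"
  by (simp add: einstein_def)

lemma star_apply: "i \<in> I \<Longrightarrow> j \<in> I \<Longrightarrow> star A (i, j) = cnj (A (j, i))"
  by (simp add: ctranspose_def)

lemma einstein_closed [simp, intro]: "A \<cdot> B \<in> T"
  by (auto simp: einstein_def tensors_def)

lemma star_closed [simp, intro]: "star A \<in> T"
  by (auto simp: ctranspose_def tensors_def)

lemma one_closed [simp, intro]: "one \<in> T"
  by (auto simp: id_tensor_def tensors_def)

lemma pow_closed [simp, intro]: "pow A k \<in> T"
  by (cases k) auto

lemma einstein_assoc: "A \<cdot> B \<cdot> C = A \<cdot> (B \<cdot> C)"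
proof (rule tensor_eqI)
  fix i j assume ij: "i \<in> I" "j \<in> I"
  have "(A \<cdot> B \<cdot> C) (i, j) = (\<Sum>k\<in>I. \<Sum>l\<in>I. A (i, l) * B (l, k) * C (k, j))"
    using ij by (simp add: einstein_apply sum_distrib_right)
  also have "\<dots> = (\<Sum>l\<in>I. \<Sum>k\<in>I. A (i, l) * B (l, k) * C (k, j))"
    by (rule sum.swap)
  also have "\<dots> = (A \<cdot> (B \<cdot> C)) (i, j)"
    using ij by (simp add: einstein_apply sum_distrib_left mult.assoc)
  finally show "(A \<cdot> B \<cdot> C) (i, j) = (A \<cdot> (B \<cdot> C)) (i, j)" .
qed auto

lemma einstein_one_right [simp]: "A \<in> T \<Longrightarrow> A \<cdot> one = A"
  by (rule tensor_eqI)
    (auto simp: einstein_apply id_tensor_def if_distrib[of "(*) z" for z] cong: if_cong)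

lemma einstein_one_left [simp]: "A \<in> T \<Longrightarrow> one \<cdot> A = A"
  by (rule tensor_eqI)
    (auto simp: einstein_apply id_tensor_def if_distrib if_distribR cong: if_cong)

lemma star_einstein: "star (A \<cdot> B) = star B \<cdot> star A"
  by (rule tensor_eqI) (auto simp: star_apply einstein_apply mult.commute)

lemma star_star [simp]: "A \<in> T \<Longrightarrow> star (star A) = A"
  by (rule tensor_eqI) (auto simp: star_apply)

lemma pow_two: "pow A 2 = A \<cdot> A"
proof -
  have "one \<cdot> A \<cdot> A = A \<cdot> A"
    by (simp add: einstein_assoc)
  then show ?thesis by (simp add: eval_nat_numeral)
qed

lemma pow_add: "pow A (k + l) = pow A k \<cdot> pow A l"
  by (induction l) (auto simp: einstein_assoc)

lemma pow_Suc_left: "A \<in> T \<Longrightarrow> pow A (Suc k) = A \<cdot> pow A k"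
  using pow_add[of A 1 k] by simp

text \<open>
  The only place where positivity over the complex numbers enters: the entries \<open>d\<close> of a column
  of \<open>B \<cdot> (X - Y)\<close> are orthogonal to all columns of \<open>B\<close>, and therefore to \<open>d\<close> itself.
\<close>

lemma star_mult_cancel:
  assumes "B \<in> T" and "star B \<cdot> (B \<cdot> X) = star B \<cdot> (B \<cdot> Y)"
  shows "B \<cdot> X = B \<cdot> Y"
proof (rule tensor_eqI)
  fix i j assume ij: "i \<in> I" "j \<in> I"
  define d where "d k = (B \<cdot> X) (k, j) - (B \<cdot> Y) (k, j)" for k
  have orth: "(\<Sum>k\<in>I. cnj (B (k, l)) * d k) = 0" if "l \<in> I" for l
  proof -
    have "(star B \<cdot> (B \<cdot> X)) (l, j) = (star B \<cdot> (B \<cdot> Y)) (l, j)"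
      using assms by simp
    then show ?thesis using that ij
      by (simp add: einstein_apply[of l j] star_apply d_def right_diff_distrib sum_subtractf)
  qed
  have "(\<Sum>k\<in>I. cnj (d k) * d k)
      = (\<Sum>k\<in>I. (\<Sum>l\<in>I. cnj (X (l, j) - Y (l, j)) * cnj (B (k, l))) * d k)"
    using ij by (intro sum.cong refl arg_cong2[where f = times])
      (auto simp: d_def einstein_apply right_diff_distrib left_diff_distrib sum_subtractf mult.commute)
  also have "\<dots> = (\<Sum>k\<in>I. \<Sum>l\<in>I. cnj (X (l, j) - Y (l, j)) * (cnj (B (k, l)) * d k))"
    by (simp only: sum_distrib_right mult.assoc)
  also have "\<dots> = (\<Sum>l\<in>I. \<Sum>k\<in>I. cnj (X (l, j) - Y (l, j)) * (cnj (B (k, l)) * d k))"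
    by (rule sum.swap)
  also have "\<dots> = (\<Sum>l\<in>I. cnj (X (l, j) - Y (l, j)) * (\<Sum>k\<in>I. cnj (B (k, l)) * d k))"
    by (simp only: sum_distrib_left)
  also have "\<dots> = 0" by (simp add: orth)
  finally have "(\<Sum>k\<in>I. cnj (d k) * d k) = 0" .
  moreover have "cnj (d k) * d k = of_real ((cmod (d k))\<^sup>2)" for k
    by (metis complex_norm_square mult.commute)
  ultimately have "(of_real (\<Sum>k\<in>I. (cmod (d k))\<^sup>2) :: complex) = 0"
    by simp
  then have "(\<Sum>k\<in>I. (cmod (d k))\<^sup>2) = 0"
    by (simp only: of_real_eq_0_iff)
  then have "d i = 0" using ij by (simp add: sum_nonneg_eq_0_iff)
  then show "(B \<cdot> X) (i, j) = (B \<cdot> Y) (i, j)" by (simp add: d_def)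
qed auto

section \<open>Ranges and factorizations\<close>

lemma einstein_vec_einstein:
  "einstein_vec n N (A \<cdot> B) X = einstein_vec n N A (einstein_vec n N B X)"
proof
  fix i
  show "einstein_vec n N (A \<cdot> B) X i = einstein_vec n N A (einstein_vec n N B X) i"
  proof (cases "i \<in> I")
    case True
    have "einstein_vec n N (A \<cdot> B) X i = (\<Sum>k\<in>I. \<Sum>l\<in>I. A (i, l) * B (l, k) * X k)"
      using True by (simp add: einstein_vec_def einstein_apply sum_distrib_right)
    also have "\<dots> = (\<Sum>l\<in>I. \<Sum>k\<in>I. A (i, l) * B (l, k) * X k)"
      by (rule sum.swap)
    also have "\<dots> = einstein_vec n N A (einstein_vec n N B X) i"
      using True by (simp add: einstein_vec_def sum_distrib_left mult.assoc)
    finally show ?thesis .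
  qed (simp add: einstein_vec_def)
qed

lemma range_einstein_subset: "range_of (A \<cdot> B) \<subseteq> range_of A"
proof -
  have "einstein_vec n N B X \<in> tvectors n N" for X
    by (simp add: einstein_vec_def tvectors_def)
  then show ?thesis
    unfolding trange_def einstein_vec_einstein by blast
qed

lemma range_subset_iff:
  assumes "A \<in> T"
  shows "range_of A \<subseteq> range_of C \<longleftrightarrow> (\<exists>Y. A = C \<cdot> Y)"
proof
  assume sub: "range_of A \<subseteq> range_of C"
  \<comment> \<open>The columns of \<open>Y\<close> are preimages under \<open>C\<close> of the columns of \<open>A\<close>.\<close>
  define unit where "unit j = (\<lambda>k\<in>I. if k = j then 1 else 0 :: complex)" for j
  have col: "\<exists>x. einstein_vec n N A (unit j) = einstein_vec n N C x" for j
  proof -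
    have "einstein_vec n N A (unit j) \<in> range_of A"
      by (auto simp: trange_def unit_def tvectors_def)
    then show ?thesis using sub by (auto simp: trange_def)
  qed
  then obtain x where x: "\<And>j. einstein_vec n N A (unit j) = einstein_vec n N C (x j)"
    by metis
  define Y :: tensor where "Y = (\<lambda>(k, j). x j k)"
  have "A = C \<cdot> Y"
  proof (rule tensor_eqI)
    fix i j assume ij: "i \<in> I" "j \<in> I"
    have "A (i, j) = einstein_vec n N A (unit j) i"
      using ij by (simp add: einstein_vec_def unit_def if_distrib[of "(*) z" for z] cong: if_cong)
    also have "\<dots> = (C \<cdot> Y) (i, j)"
      using ij unfolding x by (simp add: einstein_vec_def einstein_apply Y_def)
    finally show "A (i, j) = (C \<cdot> Y) (i, j)" .
  qed (auto simp: assms)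
  then show "\<exists>Y. A = C \<cdot> Y" by blast
qed (use range_einstein_subset in blast)

section \<open>Stabilization of powers\<close>

text \<open>
  The powers up to the dimension of the algebra satisfy a linear relation; \<open>k\<close> is the lowest exponent
  that occurs in it, and \<open>S\<close> collects the remaining terms, divided by \<open>- c k\<close> and with \<open>A\<^sup>k\<^sup>+\<^sup>1\<close> factored
  out.
\<close>

lemma pow_stabilizes:
  assumes "A \<in> T"
  obtains k S where "pow A k = pow A (Suc k) \<cdot> S" and "pow A k = S \<cdot> pow A (Suc k)"
proof -
  define d where "d = card (I \<times> I)"
  obtain c where c: "\<exists>m\<in>{..d}. c m \<noteq> 0"
      and rel: "\<And>e. e \<in> I \<times> I \<Longrightarrow> (\<Sum>m\<le>d. c m * pow A m e) = 0"
    using exists_nontrivial_relation[of "I \<times> I" "{..d}" "pow A"] by (auto simp: d_def)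
  define k where "k = (LEAST m. c m \<noteq> 0)"
  have ck: "c k \<noteq> 0"
  proof -
    obtain m where "c m \<noteq> 0" using c by blast
    then show ?thesis unfolding k_def by (rule LeastI)
  qed
  have below: "c m = 0" if "m < k" for m
    using that not_less_Least unfolding k_def by blast
  have "k \<le> d" using c below by (meson atMost_iff leI le_trans)
  define s where "s m = - c m / c k" for m
  define S :: tensor where
    "S = (\<lambda>(i, j) \<in> I \<times> I. \<Sum>m\<in>{Suc k..d}. s m * pow A (m - Suc k) (i, j))"
  have expand: "pow A k (i, j) = (\<Sum>m\<in>{Suc k..d}. s m * pow A m (i, j))"
    if "i \<in> I" "j \<in> I" for i j
  proof -
    have "0 = (\<Sum>m\<le>d. c m * pow A m (i, j))"
      using rel[of "(i, j)"] that by simp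
    also have "\<dots> = (\<Sum>m\<in>{k..d}. c m * pow A m (i, j))"
      by (rule sum.mono_neutral_right) (auto simp: below not_le)
    also have "\<dots> = c k * pow A k (i, j) + (\<Sum>m\<in>{Suc k..d}. c m * pow A m (i, j))"
      using \<open>k \<le> d\<close> by (simp add: sum.atLeast_Suc_atMost)
    finally have "pow A k (i, j) = - (\<Sum>m\<in>{Suc k..d}. c m * pow A m (i, j)) / c k"
      using ck by (simp add: field_simps eq_neg_iff_add_eq_0)
    then show ?thesis
      by (simp add: s_def sum_divide_distrib sum_negf)
  qed
  have S_apply: "S (i, j) = (\<Sum>m\<in>{Suc k..d}. s m * pow A (m - Suc k) (i, j))"
    if "i \<in> I" "j \<in> I" for i j
    using that by (simp add: S_def)
  have right: "pow A k = pow A (Suc k) \<cdot> S"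
  proof (rule tensor_eqI)
    fix i j assume ij: "i \<in> I" "j \<in> I"
    have "(pow A (Suc k) \<cdot> S) (i, j)
        = (\<Sum>l\<in>I. \<Sum>m\<in>{Suc k..d}. s m * (pow A (Suc k) (i, l) * pow A (m - Suc k) (l, j)))"
      using ij by (simp add: einstein_apply[of i j "pow A (Suc k)"] S_apply sum_distrib_left
          mult.left_commute del: tpower.simps)
    also have "\<dots> = (\<Sum>m\<in>{Suc k..d}. \<Sum>l\<in>I. s m * (pow A (Suc k) (i, l) * pow A (m - Suc k) (l, j)))"
      by (rule sum.swap)
    also have "\<dots> = (\<Sum>m\<in>{Suc k..d}. s m * (pow A (Suc k) \<cdot> pow A (m - Suc k)) (i, j))"
      using ij by (simp add: einstein_apply[of i j "pow A (Suc k)"] sum_distrib_left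
          del: tpower.simps)
    also have "\<dots> = (\<Sum>m\<in>{Suc k..d}. s m * pow A m (i, j))"
      by (intro sum.cong refl) (auto simp flip: pow_add simp del: tpower.simps)
    finally show "pow A k (i, j) = (pow A (Suc k) \<cdot> S) (i, j)"
      using expand ij by simp
  qed auto
  have left: "pow A k = S \<cdot> pow A (Suc k)"
  proof (rule tensor_eqI)
    fix i j assume ij: "i \<in> I" "j \<in> I"
    have "(S \<cdot> pow A (Suc k)) (i, j)
        = (\<Sum>l\<in>I. \<Sum>m\<in>{Suc k..d}. s m * (pow A (m - Suc k) (i, l) * pow A (Suc k) (l, j)))"
      using ij by (simp add: einstein_apply[of i j S] S_apply sum_distrib_right
          mult.assoc del: tpower.simps)
    also have "\<dots> = (\<Sum>m\<in>{Suc k..d}. \<Sum>l\<in>I. s m * (pow A (m - Suc k) (i, l) * pow A (Suc k) (l, j)))"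
      by (rule sum.swap)
    also have "\<dots> = (\<Sum>m\<in>{Suc k..d}. s m * (pow A (m - Suc k) \<cdot> pow A (Suc k)) (i, j))"
      using ij by (simp add: einstein_apply[of i j "pow A m" for m] sum_distrib_left
          del: tpower.simps)
    also have "\<dots> = (\<Sum>m\<in>{Suc k..d}. s m * pow A m (i, j))"
      by (intro sum.cong refl) (auto simp flip: pow_add simp del: tpower.simps)
    finally show "pow A k (i, j) = (S \<cdot> pow A (Suc k)) (i, j)"
      using expand ij by simp
  qed auto
  show ?thesis using that right left .
qed

text \<open>
  The index is a least number, so the range condition holds at the index only because some
  exponent satisfies it; stabilization of the powers provides one.
\<close>

lemma tindex_one_imp_factor:
  assumes A: "A \<in> T" and ind: "tindex n N A = 1"
  obtains Y where "A = A \<cdot> A \<cdot> Y"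
proof -
  let ?P = "\<lambda>k. 1 \<le> k \<and> range_of (pow A k) = range_of (pow A (k + 1))"
  obtain k S where "pow A k = pow A (Suc k) \<cdot> S"
    using pow_stabilizes[OF A] by metis
  then have "pow A (Suc k) = pow A (Suc (Suc k)) \<cdot> S"
    by (metis A pow_Suc_left einstein_assoc)
  then have "range_of (pow A (Suc k)) \<subseteq> range_of (pow A (Suc (Suc k)))"
    by (metis range_einstein_subset)
  then have "?P (Suc k)"
    using range_einstein_subset[of "pow A (Suc k)" A] by auto
  then have "?P (tindex n N A)"
    unfolding tindex_def by (rule LeastI)
  then have "range_of A = range_of (A \<cdot> A)"
    using ind A by simp
  then show thesis
    using range_subset_iff[OF A, of "A \<cdot> A"] that by blast
qed

section \<open>Group inverses\<close>

lemma group_inverseD: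
  assumes "is_group_inverse n N A X"
  shows "X \<in> T" "A \<cdot> A \<cdot> X = A" "X \<cdot> A \<cdot> X = X" "X \<cdot> A = A \<cdot> X"
  using assms unfolding is_group_inverse_def pow_two by - (elim conjE, assumption)+

lemma group_inverse_unique:
  assumes X: "is_group_inverse n N A X" and Y: "is_group_inverse n N A Y"
  shows "X = Y"
proof -
  note x = group_inverseD[OF X] and y = group_inverseD[OF Y]
  have "X \<cdot> A = X \<cdot> (A \<cdot> A \<cdot> Y)" using y by simp
  also have "\<dots> = A \<cdot> A \<cdot> X \<cdot> Y" using x by (metis einstein_assoc)
  also have "\<dots> = A \<cdot> Y" using x by simp
  finally have XA: "X \<cdot> A = A \<cdot> Y" .
  have "X = X \<cdot> A \<cdot> X" using x by simp
  also have "\<dots> = Y \<cdot> (X \<cdot> A)" using XA x y by (metis einstein_assoc)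
  also have "\<dots> = Y" using XA y by (simp flip: einstein_assoc)
  finally show ?thesis .
qed

lemma group_inv_eq: "is_group_inverse n N A X \<Longrightarrow> group_inv n N A = X"
  unfolding group_inv_def by (blast intro: group_inverse_unique)

lemma group_inv_is_group_inverse:
  "group_invertible n N A \<Longrightarrow> is_group_inverse n N A (group_inv n N A)"
  using group_inv_eq by (auto simp: group_invertible_def)

text \<open>
  The idempotent \<open>e\<close> of the proof is \<open>C \<cdot> Z\<close>, and also \<open>S \<cdot> C\<close> for an \<open>S\<close> with \<open>S \<cdot> C\<^sup>2 = C\<close>. It is
  a two-sided identity for \<open>C\<close>, and \<open>e \<cdot> Z\<close> is inverse to \<open>C\<close> with respect to it.
\<close>

lemma group_inverse_exists:
  assumes C: "C \<in> T" and CZ: "C = C \<cdot> C \<cdot> Z"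
  shows "group_invertible n N C"
proof -
  obtain k S where S: "pow C k = S \<cdot> pow C (Suc k)"
    using pow_stabilizes[OF C] by metis
  have iter: "\<exists>W. C = pow C (Suc j) \<cdot> W" for j
  proof (induction j)
    case 0
    then show ?case using C by (auto intro!: exI[of _ one])
  next
    case (Suc j)
    then obtain W where "C = pow C (Suc j) \<cdot> W" by blast
    then have "C = C \<cdot> (pow C (Suc j) \<cdot> W) \<cdot> Z" using CZ by simp
    then have "C = pow C (Suc (Suc j)) \<cdot> (W \<cdot> Z)"
      by (simp only: pow_Suc_left[OF C, of "Suc j"] einstein_assoc)
    then show ?case by blast
  qed
  then obtain W where W: "C = pow C (Suc k) \<cdot> W" by blast
  have "S \<cdot> C \<cdot> C = S \<cdot> (C \<cdot> pow C (Suc k)) \<cdot> W"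
    using W by (metis einstein_assoc)
  also have "C \<cdot> pow C (Suc k) = pow C (Suc k) \<cdot> C"
    using pow_Suc_left[OF C, of "Suc k"] by simp
  also have "S \<cdot> (pow C (Suc k) \<cdot> C) \<cdot> W = pow C k \<cdot> C \<cdot> W"
    using S by (metis einstein_assoc)
  also have "\<dots> = C" using W by simp
  finally have SC: "S \<cdot> C \<cdot> C = C" .
  define e where "e = C \<cdot> Z"
  have e: "e = S \<cdot> C"
    unfolding e_def using SC CZ by (metis einstein_assoc)
  have Ce: "C \<cdot> e = C" using CZ by (simp add: e_def einstein_assoc)
  have eC: "e \<cdot> C = C" using SC by (simp add: e)
  have ee: "e \<cdot> e = e" using eC by (simp add: e_def flip: einstein_assoc)
  define X where "X = e \<cdot> Z"
  have X: "X = S \<cdot> e" unfolding X_def by (metis e e_def einstein_assoc)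
  have CX: "C \<cdot> X = e" using Ce by (simp add: X_def e_def flip: einstein_assoc)
  have XC: "X \<cdot> C = e" by (simp add: X einstein_assoc eC e[symmetric])
  have "e \<cdot> X = X" using ee by (simp add: X_def flip: einstein_assoc)
  then have "is_group_inverse n N C X"
    using Ce CX XC by (simp add: is_group_inverse_def pow_two X_def einstein_assoc)
  then show ?thesis by (auto simp: group_invertible_def)
qed

section \<open>Core inverses\<close>

lemma core_inverseD:
  assumes "is_core_inverse n N A X"
  shows "X \<in> T" "star (A \<cdot> X) = A \<cdot> X" "X \<cdot> (A \<cdot> A) = A" "A \<cdot> (X \<cdot> X) = X"
    "A \<cdot> X \<cdot> A = A" "X \<cdot> A \<cdot> X = X"
proof -
  show *: "X \<in> T" "star (A \<cdot> X) = A \<cdot> X" "X \<cdot> (A \<cdot> A) = A" "A \<cdot> (X \<cdot> X) = X"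
    using assms by (simp_all add: is_core_inverse_def pow_two)
  have "A \<cdot> X \<cdot> A = A \<cdot> (X \<cdot> X) \<cdot> (A \<cdot> A)"
    by (metis *(3) einstein_assoc)
  then show "A \<cdot> X \<cdot> A = A" by (simp add: *)
  have "X \<cdot> A \<cdot> X = X \<cdot> (A \<cdot> A) \<cdot> (X \<cdot> X)"
    by (metis *(4) einstein_assoc)
  then show "X \<cdot> A \<cdot> X = X" by (simp add: *)
qed

lemma core_inverse_unique:
  assumes X: "is_core_inverse n N A X" and Y: "is_core_inverse n N A Y"
  shows "X = Y"
proof -
  note x = core_inverseD[OF X] and y = core_inverseD[OF Y]
  have 1: "A \<cdot> X \<cdot> (A \<cdot> Y) = A \<cdot> Y" using x(5) by (simp flip: einstein_assoc)
  have 2: "A \<cdot> Y \<cdot> (A \<cdot> X) = A \<cdot> X" using y(5) by (simp flip: einstein_assoc)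
  have P: "A \<cdot> X = A \<cdot> Y"
    by (metis 1 2 star_einstein x(2) y(2))
  have Q: "X \<cdot> A \<cdot> Y = Y"
  proof -
    have "X \<cdot> A \<cdot> Y = X \<cdot> (A \<cdot> A) \<cdot> (Y \<cdot> Y)"
      by (metis y(4) einstein_assoc)
    then show ?thesis by (simp add: x(3) y(4))
  qed
  have "X = X \<cdot> (A \<cdot> X)" using x(6) by (simp add: einstein_assoc)
  also have "\<dots> = Y" using Q by (simp add: P einstein_assoc)
  finally show ?thesis .
qed

lemma core_inv_eq: "is_core_inverse n N A X \<Longrightarrow> core_inv n N A = X"
  unfolding core_inv_def by (blast intro: core_inverse_unique)

lemma core_inv_is_core_inverse:
  "core_invertible n N A \<Longrightarrow> is_core_inverse n N A (core_inv n N A)"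
  using core_inv_eq by (auto simp: core_invertible_def)

text \<open>
  Cancelling one factor \<open>H = H\<^sup>*\<close> at a time turns stabilization of the powers of a Hermitian tensor
  into stabilization at the first power.
\<close>

lemma hermitian_cancel_pow:
  assumes H: "H \<in> T" "star H = H"
  shows "pow H k \<cdot> (H \<cdot> X) = pow H k \<cdot> (H \<cdot> Y) \<Longrightarrow> H \<cdot> X = H \<cdot> Y"
proof (induction k)
  case 0
  then show ?case by simp
next
  case (Suc k)
  have shift: "pow H (Suc k) \<cdot> (H \<cdot> Z) = H \<cdot> (H \<cdot> (pow H k \<cdot> Z))" for Z
    by (metis H(1) einstein_assoc pow_Suc_left tpower.simps(2))
  have "H \<cdot> (pow H k \<cdot> X) = H \<cdot> (pow H k \<cdot> Y)"
    using star_mult_cancel[of H] H Suc.prems unfolding shift by simp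
  then have "pow H k \<cdot> (H \<cdot> X) = pow H k \<cdot> (H \<cdot> Y)"
    by (metis H(1) einstein_assoc pow_Suc_left tpower.simps(2))
  then show ?case by (rule Suc.IH)
qed

text \<open>
  \<open>B \<cdot> X\<close> is the orthogonal projector onto the range of \<open>B\<close>; the proof takes \<open>X = S \<cdot> B\<^sup>*\<close> with \<open>S\<close>
  from the stabilization of the powers of \<open>B\<^sup>* \<cdot> B\<close>.
\<close>

lemma hermitian_projector_exists:
  assumes B: "B \<in> T"
  obtains X where "star (B \<cdot> X) = B \<cdot> X" and "B \<cdot> X \<cdot> B = B"
proof -
  define H where "H = star B \<cdot> B"
  have H: "H \<in> T" "star H = H" using B by (simp_all add: H_def star_einstein)
  obtain k S where kS: "pow H k = pow H (Suc k) \<cdot> S"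
    using pow_stabilizes[OF H(1)] by metis
  have "pow H k \<cdot> (H \<cdot> one) = pow H (Suc k) \<cdot> S \<cdot> H"
    using H kS by simp
  then have "pow H k \<cdot> (H \<cdot> one) = pow H k \<cdot> (H \<cdot> (S \<cdot> H))"
    by (simp add: einstein_assoc)
  then have "H \<cdot> one = H \<cdot> (S \<cdot> H)"
    by (rule hermitian_cancel_pow[OF H])
  then have "star B \<cdot> (B \<cdot> one) = star B \<cdot> (B \<cdot> (S \<cdot> H))"
    by (simp add: H_def einstein_assoc)
  then have "B \<cdot> one = B \<cdot> (S \<cdot> H)"
    by (rule star_mult_cancel[OF B])
  then have PB: "B \<cdot> S \<cdot> star B \<cdot> B = B"
    using B by (simp add: H_def einstein_assoc)
  define P where "P = B \<cdot> S \<cdot> star B"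
  \<comment> \<open>\<open>S\<close> need not be Hermitian, but \<open>P\<close> fixes \<open>B\<close> and hence \<open>P\<^sup>*\<close>, so \<open>P\<^sup>* = P \<cdot> P\<^sup>*\<close>.\<close>
  have "star P = B \<cdot> star S \<cdot> star B"
    using B by (simp add: P_def star_einstein einstein_assoc)
  also have "\<dots> = P \<cdot> (B \<cdot> star S \<cdot> star B)"
    using PB by (simp add: P_def flip: einstein_assoc)
  also have "\<dots> = P \<cdot> star P"
    using B by (simp add: P_def star_einstein einstein_assoc)
  finally have *: "star P = P \<cdot> star P" .
  have "star P = P"
  proof -
    have "P \<in> T" by (simp add: P_def)
    then have "P = P \<cdot> star P"
      using arg_cong[OF *, of star] by (simp add: star_einstein)
    then show ?thesis using * by simp
  qed
  then show thesis
    using that[of "S \<cdot> star B"] PB by (simp add: P_def einstein_assoc)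
qed

lemma core_inverse_exists:
  assumes B: "B \<in> T" and ind: "tindex n N B = 1"
  shows "core_invertible n N B"
proof -
  obtain Y where "B = B \<cdot> B \<cdot> Y" using tindex_one_imp_factor[OF B ind] .
  then obtain g where "is_group_inverse n N B g"
    using group_inverse_exists[OF B] by (auto simp: group_invertible_def)
  note g = group_inverseD[OF this]
  obtain X where X: "star (B \<cdot> X) = B \<cdot> X" "B \<cdot> X \<cdot> B = B"
    using hermitian_projector_exists[OF B] .
  define P where "P = B \<cdot> X"
  have P: "star P = P" "P \<cdot> B = B" using X by (simp_all add: P_def)
  have BgB: "B \<cdot> g \<cdot> B = B" using g by (metis einstein_assoc)
  have gBB: "g \<cdot> (B \<cdot> B) = B" using g by (metis einstein_assoc)
  have g_eq: "B \<cdot> (g \<cdot> g) = g" using g by (metis einstein_assoc)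
  have Pg: "P \<cdot> g = g" using P g_eq by (metis einstein_assoc)
  define b where "b = g \<cdot> P"
  have Bb: "B \<cdot> b = P"
    using BgB by (simp add: b_def P_def flip: einstein_assoc)
  have "b \<cdot> (B \<cdot> B) = B"
    using P gBB by (metis b_def einstein_assoc)
  moreover have "B \<cdot> (b \<cdot> b) = b"
    using Bb Pg by (metis b_def einstein_assoc)
  ultimately have "is_core_inverse n N B b"
    using Bb P by (simp add: is_core_inverse_def pow_two b_def)
  then show ?thesis by (auto simp: core_invertible_def)
qed

section \<open>The reverse order law\<close>

text \<open>The implication from (a) to (b).\<close>

lemma core_eq_imp_commute_and_range:
  assumes A: "A \<in> T" and a: "is_core_inverse n N A a"
    and G: "is_group_inverse n N (A \<cdot> B) G" and aG: "a = B \<cdot> G"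
  shows "a \<cdot> A \<cdot> B = B \<cdot> A \<cdot> a" and "range_of A \<subseteq> range_of (A \<cdot> B)"
proof -
  note a = core_inverseD[OF a] and g = group_inverseD[OF G]
  show "a \<cdot> A \<cdot> B = B \<cdot> A \<cdot> a"
    using g(4) by (simp add: aG einstein_assoc)
  have "A = A \<cdot> B \<cdot> (G \<cdot> A)"
    using a(5) by (simp add: aG einstein_assoc)
  then show "range_of A \<subseteq> range_of (A \<cdot> B)"
    using range_subset_iff[OF A] by blast
qed

text \<open>
  The converse, with the additional information that the group inverse of \<open>A \<cdot> B\<close> is also its core
  inverse, which is part of (c). Neither inverse of \<open>A \<cdot> B\<close> is assumed to exist, and \<open>B\<close> is arbitrary.
\<close>

lemma commute_and_range_imp_core_eq:
  assumes A: "A \<in> T" and a: "is_core_inverse n N A a"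
    and comm: "a \<cdot> A \<cdot> B = B \<cdot> A \<cdot> a" and sub: "range_of A \<subseteq> range_of (A \<cdot> B)"
  obtains G where "is_group_inverse n N (A \<cdot> B) G" "is_core_inverse n N (A \<cdot> B) G" "a = B \<cdot> G"
proof -
  note a = core_inverseD[OF a]
  define C where "C = A \<cdot> B"
  define P where "P = A \<cdot> a"
  have CT: "C \<in> T" by (simp add: C_def)
  obtain Y where Y: "A = C \<cdot> Y"
    using sub range_subset_iff[OF A] by (auto simp: C_def)
  have "C \<cdot> P = A \<cdot> (a \<cdot> A \<cdot> B)"
    unfolding comm by (simp add: C_def P_def einstein_assoc)
  then have CP: "C \<cdot> P = C"
    using a(5) by (simp add: C_def flip: einstein_assoc)
  have PC: "P \<cdot> C = C"
    using a(5) by (simp add: C_def P_def flip: einstein_assoc)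
  have PCYa: "P = C \<cdot> (Y \<cdot> a)"
    using Y by (metis P_def einstein_assoc)
  have "C = C \<cdot> C \<cdot> (Y \<cdot> a)"
    using CP PCYa by (simp add: einstein_assoc)
  then obtain G where G: "is_group_inverse n N C G"
    using group_inverse_exists[OF CT] by (auto simp: group_invertible_def)
  note g = group_inverseD[OF G]
  have GGC: "G = G \<cdot> G \<cdot> C" using g by (metis einstein_assoc)
  have GP: "G \<cdot> P = G" using GGC CP by (metis einstein_assoc)
  have CG: "C \<cdot> G = P"
  proof -
    have "C \<cdot> G = C \<cdot> G \<cdot> P" using GP by (simp add: einstein_assoc)
    also have "\<dots> = C \<cdot> G \<cdot> C \<cdot> (Y \<cdot> a)" by (simp add: PCYa einstein_assoc)
    also have "C \<cdot> G \<cdot> C = C" using g by (metis einstein_assoc)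
    finally show ?thesis using PCYa by simp
  qed
  have PG: "P \<cdot> G = G" using CG g by metis
  have "B \<cdot> G = B \<cdot> A \<cdot> a \<cdot> G" using PG by (simp add: P_def einstein_assoc)
  also have "\<dots> = a \<cdot> (C \<cdot> G)" unfolding comm[symmetric] by (simp add: C_def einstein_assoc)
  also have "\<dots> = a" using a(6) by (simp add: CG P_def einstein_assoc)
  finally have aG: "a = B \<cdot> G" ..
  have "G \<cdot> (C \<cdot> C) = C" "C \<cdot> (G \<cdot> G) = G"
    using g by (metis einstein_assoc)+
  then have "is_core_inverse n N C G"
    using a(2) g(1) CG by (simp add: is_core_inverse_def pow_two P_def)
  then show thesis using that G aG by (simp add: C_def)
qed

text \<open>The rest of (c) follows from (a).\<close>

lemma core_eq_imp_reverse_order: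
  assumes A: "A \<in> T" and a: "is_core_inverse n N A a" and b: "is_core_inverse n N B b"
    and G: "is_group_inverse n N (A \<cdot> B) G" and aG: "a = B \<cdot> G"
  shows "G = b \<cdot> a" and "range_of A \<subseteq> range_of B"
proof -
  note a = core_inverseD[OF a] and b = core_inverseD[OF b] and g = group_inverseD[OF G]
  have AB: "A = B \<cdot> (G \<cdot> (A \<cdot> A))"
    using a(3) by (simp add: aG einstein_assoc)
  then show "range_of A \<subseteq> range_of B"
    using range_subset_iff[OF A] by blast
  have "G = A \<cdot> (B \<cdot> (G \<cdot> G))" using g by (metis einstein_assoc)
  then obtain Z where Z: "G = B \<cdot> Z" using AB by (metis einstein_assoc)
  have "b \<cdot> a = b \<cdot> (B \<cdot> B) \<cdot> Z" by (simp add: aG Z einstein_assoc)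
  then show "G = b \<cdot> a" by (simp add: b(3) Z)
qed

text \<open>
  The implication from (c) to (a), where \<open>b \<cdot> a\<close> is the group inverse of \<open>A \<cdot> B\<close>; only the range
  inclusion of (c) is needed to see that \<open>B \<cdot> b\<close> fixes \<open>a\<close>.
\<close>

lemma reverse_order_imp_core_eq:
  assumes A: "A \<in> T" and a: "is_core_inverse n N A a" and b: "is_core_inverse n N B b"
    and sub: "range_of A \<subseteq> range_of B"
  shows "a = B \<cdot> (b \<cdot> a)"
proof -
  note a = core_inverseD[OF a] and b = core_inverseD[OF b]
  obtain Y where Y: "A = B \<cdot> Y" using sub range_subset_iff[OF A] by blast
  have "a = B \<cdot> (Y \<cdot> (a \<cdot> a))" using a(4) Y by (metis einstein_assoc)
  then show ?thesis using b(5) by (metis einstein_assoc)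
qed

end

theorem theorem4p2:
  fixes n :: nat and N :: "nat \<Rightarrow> nat" and A B :: tensor
  assumes "1 \<le> n" and "\<forall>k\<in>{1..n}. 1 \<le> N k"
    and "A \<in> tensors n N" and "B \<in> tensors n N"
    and "tindex n N A = 1" and "tindex n N B = 1"
  shows
    "let a = (core_invertible n N A \<and> group_invertible n N (A \<star>\<^bsub>n,N\<^esub> B) \<and>
              core_inv n N A = B \<star>\<^bsub>n,N\<^esub> group_inv n N (A \<star>\<^bsub>n,N\<^esub> B));
         b = (core_invertible n N A \<and>
              core_inv n N A \<star>\<^bsub>n,N\<^esub> A \<star>\<^bsub>n,N\<^esub> B = B \<star>\<^bsub>n,N\<^esub> A \<star>\<^bsub>n,N\<^esub> core_inv n N A \<and>
              trange n N A \<subseteq> trange n N (A \<star>\<^bsub>n,N\<^esub> B));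
         c = (core_invertible n N A \<and> core_invertible n N B \<and>
              group_invertible n N (A \<star>\<^bsub>n,N\<^esub> B) \<and> core_invertible n N (A \<star>\<^bsub>n,N\<^esub> B) \<and>
              group_inv n N (A \<star>\<^bsub>n,N\<^esub> B) = core_inv n N (A \<star>\<^bsub>n,N\<^esub> B) \<and>
              core_inv n N (A \<star>\<^bsub>n,N\<^esub> B) = core_inv n N B \<star>\<^bsub>n,N\<^esub> core_inv n N A \<and>
              trange n N A \<subseteq> trange n N B)
     in (a \<longleftrightarrow> b) \<and> (b \<longleftrightarrow> c)"
proof -
  interpret tensor_algebra n N .
  let ?a = "core_invertible n N A \<and> group_invertible n N (A \<cdot> B) \<and>
    core_inv n N A = B \<cdot> group_inv n N (A \<cdot> B)"
  let ?b = "core_invertible n N A \<and>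
    core_inv n N A \<cdot> A \<cdot> B = B \<cdot> A \<cdot> core_inv n N A \<and> range_of A \<subseteq> range_of (A \<cdot> B)"
  let ?c = "core_invertible n N A \<and> core_invertible n N B \<and>
    group_invertible n N (A \<cdot> B) \<and> core_invertible n N (A \<cdot> B) \<and>
    group_inv n N (A \<cdot> B) = core_inv n N (A \<cdot> B) \<and>
    core_inv n N (A \<cdot> B) = core_inv n N B \<cdot> core_inv n N A \<and> range_of A \<subseteq> range_of B"
  have A: "A \<in> T" and B: "core_invertible n N B"
    using assms core_inverse_exists by auto
  have "?a \<Longrightarrow> ?b"
    using core_eq_imp_commute_and_range[OF A core_inv_is_core_inverse group_inv_is_group_inverse]
    by blast
  moreover have "?c" if b: ?b
  proof -
    obtain G where G: "is_group_inverse n N (A \<cdot> B) G" "is_core_inverse n N (A \<cdot> B) G"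
        "core_inv n N A = B \<cdot> G"
      using commute_and_range_imp_core_eq[OF A core_inv_is_core_inverse] b by blast
    have "G = core_inv n N B \<cdot> core_inv n N A" "range_of A \<subseteq> range_of B"
      using core_eq_imp_reverse_order[OF A core_inv_is_core_inverse core_inv_is_core_inverse]
        b B G by blast+
    then show ?c
      using b B G group_inv_eq[OF G(1)] core_inv_eq[OF G(2)]
      by (auto simp: group_invertible_def core_invertible_def)
  qed
  moreover have "?c \<Longrightarrow> ?a"
    using reverse_order_imp_core_eq[OF A core_inv_is_core_inverse core_inv_is_core_inverse, of B]
    by simp
  ultimately show ?thesis unfolding Let_def by blast
qed

end
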